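(* Let $\Omega$ be a measurable space. For a finitely additive integration operator $\phi$ on $\Omega$ define $\Lambda(\phi)$ by $\Lambda(\phi)(A)=\phi(\chi_A)$ for $A\subseteq\Omega$ measurable, where $\chi_A\colon\Omega\to I$ is the characteristic function of $A$. Then (i) $\Lambda$ is a bijection $S\Omega\cong F\Omega$ from the set of finitely additive integration operators on $\Omega$ to the set of finitely additive probability measures on $\Omega$; and (ii) $\Lambda$ restricts to a bijection $\Xi\colon T\Omega\cong G\Omega$ from the set of (countably additive) integration operators on $\Omega$ to the set of probability measures on $\Omega$.
   Context: $I=[0,1]$ with its Borel $\sigma$-algebra; $\mathbf{Meas}(\Omega,I)$ is the set of measurable maps $\Omega\to I$; $\bar r$ denotes the constant function with value $r$. A finitely additive integration operator on $\Omega$ is a function $\phi\colon\mathbf{Meas}(\Omega,I)\to I$ that is affine ($\phi(rf+(1-r)g)=r\phi(f)+(1-r)\phi(g)$ for all $f,g\in\mathbf{Meas}(\Omega,I)$, $r\in I$) and weakly averaging ($\phi(\bar r)=r$ for all $r\in I$). It is an integration operator (countably additive) if additionally it respects limits: whenever $f_n\in\mathbf{Meas}(\Omega,I)$ is a sequence converging pointwise to $0$, then $\phi(f_n)\to 0$. $S\Omega$ is the set of finitely additive integration operators on $\Omega$ and $T\Omega\subseteq S\Omega$ the set of integration operators. A finitely additive probability measure on $(\Omega,\Sigma)$ is $\pi\colon\Sigma\to I$ with $\pi(\Omega)=1$ and $\pi(A\cup B)=\pi(A)+\pi(B)$ for disjoint $A,B\in\Sigma$; it is a probability measure if it is moreover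 countably additive. $F\Omega$ is the set of finitely additive probability measures on $\Omega$ and $G\Omega\subseteq F\Omega$ the set of probability measures. *)

theory Defs
  imports "HOL-Analysis.Analysis"
begin

text \<open>
  A measurable space is represented by a value \<open>M :: 'a measure\<close>, of which only \<open>space M\<close> and
  \<open>sets M\<close> are used; the measure that \<open>M\<close> carries plays no role.
  Maps with a set-theoretic domain (measurable maps, integration operators, finitely additive
  measures) are encoded as extensional functions, so that equality of functions is equality of
  maps on their domain.
\<close>

abbreviation unit_I :: "real set" where
  "unit_I \<equiv> {0..1}"

definition Meas :: "'a measure \<Rightarrow> ('a \<Rightarrow> real) set" where
  "Meas M = (M \<rightarrow>\<^sub>M restrict_space borel unit_I) \<inter> extensional (space M)"

definition const_map :: "'a measure \<Rightarrow> real \<Rightarrow> 'a \<Rightarrow> real" where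
  "const_map M r = (\<lambda>x\<in>space M. r)"

definition char_map :: "'a measure \<Rightarrow> 'a set \<Rightarrow> 'a \<Rightarrow> real" where
  "char_map M A = (\<lambda>x\<in>space M. indicator A x)"

definition cvx_comb :: "'a measure \<Rightarrow> real \<Rightarrow> ('a \<Rightarrow> real) \<Rightarrow> ('a \<Rightarrow> real) \<Rightarrow> 'a \<Rightarrow> real" where
  "cvx_comb M r f g = (\<lambda>x\<in>space M. r * f x + (1 - r) * g x)"

definition affine_op :: "'a measure \<Rightarrow> (('a \<Rightarrow> real) \<Rightarrow> real) \<Rightarrow> bool" where
  "affine_op M \<phi> \<longleftrightarrow>
     (\<forall>f\<in>Meas M. \<forall>g\<in>Meas M. \<forall>r\<in>unit_I. \<phi> (cvx_comb M r f g) = r * \<phi> f + (1 - r) * \<phi> g)"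

definition weakly_averaging :: "'a measure \<Rightarrow> (('a \<Rightarrow> real) \<Rightarrow> real) \<Rightarrow> bool" where
  "weakly_averaging M \<phi> \<longleftrightarrow> (\<forall>r\<in>unit_I. \<phi> (const_map M r) = r)"

definition respects_limits :: "'a measure \<Rightarrow> (('a \<Rightarrow> real) \<Rightarrow> real) \<Rightarrow> bool" where
  "respects_limits M \<phi> \<longleftrightarrow>
     (\<forall>f :: nat \<Rightarrow> 'a \<Rightarrow> real. (\<forall>n. f n \<in> Meas M) \<longrightarrow>
        (\<forall>x\<in>space M. (\<lambda>n. f n x) \<longlonglongrightarrow> 0) \<longrightarrow> (\<lambda>n. \<phi> (f n)) \<longlonglongrightarrow> 0)"

definition fa_integration_ops :: "'a measure \<Rightarrow> (('a \<Rightarrow> real) \<Rightarrow> real) set" where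
  "fa_integration_ops M = {\<phi> \<in> Meas M \<rightarrow>\<^sub>E unit_I. affine_op M \<phi> \<and> weakly_averaging M \<phi>}"

definition integration_ops :: "'a measure \<Rightarrow> (('a \<Rightarrow> real) \<Rightarrow> real) set" where
  "integration_ops M = {\<phi> \<in> fa_integration_ops M. respects_limits M \<phi>}"

definition fa_prob_measures :: "'a measure \<Rightarrow> ('a set \<Rightarrow> real) set" where
  "fa_prob_measures M =
     {\<pi> \<in> sets M \<rightarrow>\<^sub>E unit_I. \<pi> (space M) = 1 \<and> additive (sets M) \<pi>}"

text \<open>
  The library's \<open>countably_additive\<close> is stated for \<open>ennreal\<close>-valued set functions; since \<open>\<pi>\<close> is
  real-valued, convergence of the series is made explicit by \<open>sums\<close>.
\<close>

definition prob_measures :: "'a measure \<Rightarrow> ('a set \<Rightarrow> real) set" where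
  "prob_measures M =
     {\<pi> \<in> fa_prob_measures M. \<forall>A :: nat \<Rightarrow> 'a set. range A \<subseteq> sets M \<longrightarrow> disjoint_family A \<longrightarrow>
        (\<lambda>n. \<pi> (A n)) sums \<pi> (\<Union>n. A n)}"

definition Lam :: "'a measure \<Rightarrow> (('a \<Rightarrow> real) \<Rightarrow> real) \<Rightarrow> 'a set \<Rightarrow> real" where
  "Lam M \<phi> = (\<lambda>A\<in>sets M. \<phi> (char_map M A))"

end

theory Submission
  imports Defs
begin

text \<open>
  An affine, weakly averaging operator is homogeneous, monotone and additive whenever the sum stays
  in \<open>I\<close>. Every \<open>f\<close> is within \<open>1/N\<close> of \<open>\<lfloor>N f\<rfloor> / N = (1/N) \<Sum>\<^sub>k \<chi>{f \<ge> k/N}\<close>, so the operator is determined by its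
  values on characteristic functions. Conversely, a finitely additive \<open>\<pi>\<close> integrates simple functions,
  and the supremum over simple minorants extends this to all of \<open>Meas\<close> by uniform approximation.
  If \<open>\<pi>\<close> is countably additive, uniqueness identifies the operator with the Lebesgue integral,
  which respects limits by dominated convergence; the other direction applies the limit condition
  to the characteristic functions of the tails of a disjoint union.
\<close>

section \<open>Measurable maps into the unit interval\<close>

lemma Meas_iff:
  "f \<in> Meas M \<longleftrightarrow>
     f \<in> borel_measurable M \<and> (\<forall>x\<in>space M. 0 \<le> f x \<and> f x \<le> 1) \<and> f \<in> extensional (space M)"
  unfolding Meas_def by (auto simp: measurable_restrict_space2_iff Pi_iff)

lemma restrict_Meas:
  assumes "f \<in> borel_measurable M" "\<And>x. x \<in> space M \<Longrightarrow> 0 \<le> f x" "\<And>x. x \<in> space M \<Longrightarrow> f x \<le> 1"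
  shows "(\<lambda>x\<in>space M. f x) \<in> Meas M"
proof -
  have "(\<lambda>x\<in>space M. f x) \<in> borel_measurable M"
    using assms(1) by (rule measurable_cong[THEN iffD1, rotated]) auto
  then show ?thesis using assms(2,3) by (auto simp: Meas_iff)
qed

lemma Meas_eqI:
  assumes "f \<in> Meas M" "g \<in> Meas M" "\<And>x. x \<in> space M \<Longrightarrow> f x = g x"
  shows "f = g"
  using assms by (auto simp: Meas_iff intro: extensionalityI)

lemma const_map_Meas: "r \<in> unit_I \<Longrightarrow> const_map M r \<in> Meas M"
  unfolding const_map_def by (rule restrict_Meas) auto

lemma char_map_Meas: "A \<in> sets M \<Longrightarrow> char_map M A \<in> Meas M"
  unfolding char_map_def by (rule restrict_Meas) auto

lemma cvx_comb_Meas: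
  assumes "f \<in> Meas M" "g \<in> Meas M" "r \<in> unit_I"
  shows "cvx_comb M r f g \<in> Meas M"
  unfolding cvx_comb_def
proof (rule restrict_Meas)
  show "(\<lambda>x. r * f x + (1 - r) * g x) \<in> borel_measurable M"
    using assms by (auto simp: Meas_iff)
next
  fix x assume x: "x \<in> space M"
  show "0 \<le> r * f x + (1 - r) * g x" using assms x by (auto simp: Meas_iff)
  have "r * f x + (1 - r) * g x \<le> r * 1 + (1 - r) * 1"
    using assms x by (intro add_mono mult_left_mono) (auto simp: Meas_iff)
  then show "r * f x + (1 - r) * g x \<le> 1" by simp
qed

section \<open>Uniqueness\<close>

lemma fa_op_affine:
  assumes "\<phi> \<in> fa_integration_ops M" "f \<in> Meas M" "g \<in> Meas M" "r \<in> unit_I"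
  shows "\<phi> (cvx_comb M r f g) = r * \<phi> f + (1 - r) * \<phi> g"
  using assms by (auto simp: fa_integration_ops_def affine_op_def)

lemma fa_op_const:
  assumes "\<phi> \<in> fa_integration_ops M" "r \<in> unit_I"
  shows "\<phi> (const_map M r) = r"
  using assms by (auto simp: fa_integration_ops_def weakly_averaging_def)

lemma fa_op_bounds:
  assumes "\<phi> \<in> fa_integration_ops M" "f \<in> Meas M"
  shows "0 \<le> \<phi> f" "\<phi> f \<le> 1"
  using assms by (auto simp: fa_integration_ops_def PiE_iff)

text \<open>The map \<open>r * f\<close> is the convex combination of \<open>f\<close> with the zero
  map, and weak averaging gives the zero map the value 0. Passing the product as a separate map
  \<open>g\<close> lets callers match it pointwise.\<close>

lemma fa_op_scale:
  assumes "\<phi> \<in> fa_integration_ops M" "f \<in> Meas M" "g \<in> Meas M" "r \<in> unit_I"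
    and eq: "\<And>x. x \<in> space M \<Longrightarrow> g x = r * f x"
  shows "\<phi> g = r * \<phi> f"
proof -
  have z: "const_map M 0 \<in> Meas M" by (rule const_map_Meas) auto
  have "g = cvx_comb M r f (const_map M 0)"
    by (rule Meas_eqI[OF assms(3) cvx_comb_Meas[OF assms(2) z assms(4)]])
      (simp add: eq cvx_comb_def const_map_def)
  then show ?thesis
    using fa_op_affine[OF assms(1,2) z assms(4)] fa_op_const[OF assms(1), of 0] by simp
qed

text \<open>A sum is not a convex combination, but half of it is the midpoint of \<open>f\<close>
  and \<open>g\<close>. Evaluating this midpoint by affinity and by scaling \<open>h\<close> with
  1/2 gives the claim.\<close>

lemma fa_op_add:
  assumes "\<phi> \<in> fa_integration_ops M" "f \<in> Meas M" "g \<in> Meas M" "h \<in> Meas M"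
    and eq: "\<And>x. x \<in> space M \<Longrightarrow> h x = f x + g x"
  shows "\<phi> h = \<phi> f + \<phi> g"
proof -
  have half: "(1/2::real) \<in> unit_I" by simp
  have "\<phi> (cvx_comb M (1/2) f g) = 1/2 * \<phi> h"
    by (rule fa_op_scale[OF assms(1,4) cvx_comb_Meas[OF assms(2,3) half] half])
      (simp add: eq cvx_comb_def field_simps)
  then show ?thesis using fa_op_affine[OF assms(1-3) half] by simp
qed

text \<open>The difference \<open>g - f\<close> is again a map into the unit interval, so additivity
  applies and its value is nonnegative.\<close>

lemma fa_op_mono:
  assumes "\<phi> \<in> fa_integration_ops M" "f \<in> Meas M" "g \<in> Meas M"
    and le: "\<And>x. x \<in> space M \<Longrightarrow> f x \<le> g x"
  shows "\<phi> f \<le> \<phi> g"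
proof -
  have bnd: "g x - f x \<le> 1" if "x \<in> space M" for x
    using assms(2,3) that by (fastforce simp: Meas_iff)
  have d: "(\<lambda>x\<in>space M. g x - f x) \<in> Meas M"
    using assms bnd by (intro restrict_Meas) (auto simp: Meas_iff)
  have "\<phi> g = \<phi> f + \<phi> (\<lambda>x\<in>space M. g x - f x)"
    by (rule fa_op_add[OF assms(1,2) d assms(3)]) simp
  with fa_op_bounds[OF assms(1) d] show ?thesis by simp
qed

text \<open>This increment builds the staircase below \<open>f\<close> one characteristic function
  at a time: raising the cap by one adds 1 exactly where \<open>y\<close> has reached the new
  level.\<close>

lemma floor_step:
  fixes y :: real and k :: nat
  shows "real_of_int (min (int (Suc k)) \<lfloor>y\<rfloor>) =
    real_of_int (min (int k) \<lfloor>y\<rfloor>) + (if real (Suc k) \<le> y then 1 else 0)"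
proof -
  have "real (Suc k) \<le> y \<longleftrightarrow> int (Suc k) \<le> \<lfloor>y\<rfloor>"
    by (simp only: le_floor_iff of_int_of_nat_eq)
  then show ?thesis by (auto simp: min_def)
qed

lemma fa_op_eqI:
  assumes \<phi>: "\<phi> \<in> fa_integration_ops M" and \<psi>: "\<psi> \<in> fa_integration_ops M"
    and char: "\<And>A. A \<in> sets M \<Longrightarrow> \<phi> (char_map M A) = \<psi> (char_map M A)"
  shows "\<phi> = \<psi>"
proof (rule extensionalityI)
  show "\<phi> \<in> extensional (Meas M)" "\<psi> \<in> extensional (Meas M)"
    using \<phi> \<psi> by (auto simp: fa_integration_ops_def PiE_def)
next
  fix f assume f: "f \<in> Meas M"
  have f_meas [measurable]: "f \<in> borel_measurable M" using f by (auto simp: Meas_iff)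
  have f01: "0 \<le> f x" "f x \<le> 1" if "x \<in> space M" for x using f that by (auto simp: Meas_iff)
  have close: "\<bar>\<phi> f - \<psi> f\<bar> \<le> 1 / N" if N: "N \<ge> 1" for N :: nat
  proof -
    have iN: "1 / real N \<in> unit_I" using N by (auto simp: field_simps)
    \<comment> \<open>\<open>g k\<close> is the sum of the lowest \<open>k\<close> layers of height
      \<open>1/N\<close>, that is \<open>(1/N)\<close> times the sum of the characteristic functions
      of \<open>f >= j/N\<close> for \<open>j = 1..k\<close>. Capping the floor keeps every partial
      sum in the unit interval and allows induction on \<open>k\<close>.\<close>
    define g where "g k = (\<lambda>x\<in>space M. real_of_int (min (int k) \<lfloor>N * f x\<rfloor>) / N)" for k :: nat
    have fl: "real_of_int \<lfloor>N * f x\<rfloor> / N \<le> f x" "f x - real_of_int \<lfloor>N * f x\<rfloor> / N \<le> 1 / N" for x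
    proof -
      have "real_of_int \<lfloor>N * f x\<rfloor> \<le> N * f x" "N * f x \<le> real_of_int \<lfloor>N * f x\<rfloor> + 1"
        by linarith+
      then have "real_of_int \<lfloor>N * f x\<rfloor> / N \<le> f x" "f x \<le> (real_of_int \<lfloor>N * f x\<rfloor> + 1) / N"
        using N by (simp_all add: pos_divide_le_eq pos_le_divide_eq mult.commute)
      then show "real_of_int \<lfloor>N * f x\<rfloor> / N \<le> f x" "f x - real_of_int \<lfloor>N * f x\<rfloor> / N \<le> 1 / N"
        by (simp_all add: add_divide_distrib)
    qed
    have gM: "g k \<in> Meas M" for k
      unfolding g_def
    proof (rule restrict_Meas)
      show "(\<lambda>x. real_of_int (min (int k) \<lfloor>N * f x\<rfloor>) / N) \<in> borel_measurable M" by measurable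
    next
      fix x assume x: "x \<in> space M"
      have "0 \<le> real N * f x" using f01[OF x] by simp
      then have "0 \<le> \<lfloor>real N * f x\<rfloor>" by simp
      then show "0 \<le> real_of_int (min (int k) \<lfloor>N * f x\<rfloor>) / N" by (simp add: min_def)
      have "real_of_int (min (int k) \<lfloor>N * f x\<rfloor>) / N \<le> real_of_int \<lfloor>N * f x\<rfloor> / N"
        by (intro divide_right_mono) auto
      with fl(1)[of x] f01(2)[OF x] show "real_of_int (min (int k) \<lfloor>N * f x\<rfloor>) / N \<le> 1" by linarith
    qed
    have g_eq: "\<phi> (g k) = \<psi> (g k)" for k
    proof (induction k)
      case 0
      have "g 0 = const_map M 0"
      proof (rule Meas_eqI[OF gM const_map_Meas])
        fix x assume x: "x \<in> space M"
        then have "0 \<le> real N * f x" using f01[OF x] by simp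
        then have "0 \<le> \<lfloor>real N * f x\<rfloor>" by simp
        then show "g 0 x = const_map M 0 x" using x by (simp add: g_def const_map_def)
      qed simp
      then show ?case using fa_op_const[OF \<phi>, of 0] fa_op_const[OF \<psi>, of 0] by simp
    next
      case (Suc k)
      \<comment> \<open>The set where \<open>f >= (k+1)/N\<close>; the map \<open>c\<close> below is
        the layer that leads from \<open>g k\<close> to \<open>g (Suc k)\<close>.\<close>
      define A where "A = {x \<in> space M. real (Suc k) \<le> N * f x}"
      have A: "A \<in> sets M" unfolding A_def by measurable
      define c where "c = (\<lambda>x\<in>space M. 1 / real N * char_map M A x)"
      have c: "c \<in> Meas M"
        unfolding c_def
      proof (rule restrict_Meas)
        show "(\<lambda>x. 1 / real N * char_map M A x) \<in> borel_measurable M"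
          using char_map_Meas[OF A] by (auto simp: Meas_iff)
      qed (use N in \<open>auto simp: char_map_def indicator_def\<close>)
      have "\<phi>' c = 1 / N * \<phi>' (char_map M A)" if "\<phi>' \<in> fa_integration_ops M" for \<phi>'
        by (rule fa_op_scale[OF that char_map_Meas[OF A] c iN]) (simp add: c_def)
      from this[OF \<phi>] this[OF \<psi>] have ceq: "\<phi> c = \<psi> c" using char[OF A] by simp
      have step: "g (Suc k) x = g k x + c x" if "x \<in> space M" for x
        using that unfolding g_def c_def char_map_def A_def
        by (simp only: restrict_apply' floor_step) (auto simp: add_divide_distrib)
      have "\<phi>' (g (Suc k)) = \<phi>' (g k) + \<phi>' c" if "\<phi>' \<in> fa_integration_ops M" for \<phi>'
        by (rule fa_op_add[OF that gM c gM step])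
      from this[OF \<phi>] this[OF \<psi>] show ?case using Suc.IH ceq by simp
    qed
    define h where "h = (\<lambda>x\<in>space M. f x - g N x)"
    \<comment> \<open>At \<open>k = N\<close> the cap is inactive, since \<open>f <= 1\<close>
      bounds the floor by \<open>N\<close>.\<close>
    have gN: "g N x = real_of_int \<lfloor>N * f x\<rfloor> / N" if x: "x \<in> space M" for x
    proof -
      have "\<lfloor>N * f x\<rfloor> \<le> int N"
        using f01[OF x] N by (simp add: floor_le_iff) (smt (verit) mult_left_le of_nat_0_le_iff)
      then show ?thesis using x by (simp add: g_def)
    qed
    have h_le: "h x \<le> 1 / N" if "x \<in> space M" for x
      using fl(2)[of x] gN[OF that] that by (simp add: h_def)
    have hM: "h \<in> Meas M"
    proof -
      have "g N \<in> borel_measurable M" using gM by (auto simp: Meas_iff)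
      moreover have "f x - g N x \<le> 1" if "x \<in> space M" for x
        using h_le[OF that] iN that by (simp add: h_def)
      ultimately show ?thesis
        unfolding h_def using fl(1) gN by (intro restrict_Meas) auto
    qed
    \<comment> \<open>Stated for an arbitrary operator and used for both: each value at
      \<open>f\<close> exceeds the common value at \<open>g N\<close> by an amount between 0 and
      \<open>1/N\<close>, so the two differ by at most \<open>1/N\<close>.\<close>
    have "\<phi>' f = \<phi>' (g N) + \<phi>' h \<and> 0 \<le> \<phi>' h \<and> \<phi>' h \<le> 1 / N"
      if *: "\<phi>' \<in> fa_integration_ops M" for \<phi>'
    proof (intro conjI)
      show "\<phi>' f = \<phi>' (g N) + \<phi>' h" by (rule fa_op_add[OF * gM hM f]) (simp add: h_def)
      show "0 \<le> \<phi>' h" by (rule fa_op_bounds[OF * hM])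
      have "\<phi>' h \<le> \<phi>' (const_map M (1 / N))"
        by (rule fa_op_mono[OF * hM const_map_Meas[OF iN]]) (simp add: const_map_def h_le)
      then show "\<phi>' h \<le> 1 / N" using fa_op_const[OF * iN] by simp
    qed
    from this[OF \<phi>] this[OF \<psi>] g_eq[of N] show ?thesis by linarith
  qed
  show "\<phi> f = \<psi> f"
  proof (rule ccontr)
    assume "\<phi> f \<noteq> \<psi> f"
    then have "0 < \<bar>\<phi> f - \<psi> f\<bar>" by simp
    then obtain n where "inverse (real (Suc n)) < \<bar>\<phi> f - \<psi> f\<bar>" using reals_Archimedean by blast
    then show False using close[of "Suc n"] by (simp add: inverse_eq_divide)
  qed
qed

section \<open>Integration of simple functions\<close>

locale fa_prob =
  fixes M :: "'a measure" and \<pi> :: "'a set \<Rightarrow> real"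
  assumes fa: "\<pi> \<in> fa_prob_measures M"
begin

lemma nonneg: "A \<in> sets M \<Longrightarrow> 0 \<le> \<pi> A"
  and space_one: "\<pi> (space M) = 1"
  and union: "A \<in> sets M \<Longrightarrow> B \<in> sets M \<Longrightarrow> A \<inter> B = {} \<Longrightarrow> \<pi> (A \<union> B) = \<pi> A + \<pi> B"
  using fa by (auto simp: fa_prob_measures_def additive_def PiE_iff)

lemma empty: "\<pi> {} = 0"
  using union[of "{}" "{}"] by simp

lemma finite_union:
  assumes "finite I" "\<And>i. i \<in> I \<Longrightarrow> A i \<in> sets M" "disjoint_family_on A I"
  shows "\<pi> (\<Union>i\<in>I. A i) = (\<Sum>i\<in>I. \<pi> (A i))"
  using assms
proof (induction I rule: finite_induct)
  case (insert i I)
  have "\<pi> (A i \<union> (\<Union>i\<in>I. A i)) = \<pi> (A i) + \<pi> (\<Union>i\<in>I. A i)"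
    using insert by (intro union sets.finite_UN) (auto simp: disjoint_family_on_def)
  then show ?case
    using insert by (simp add: disjoint_family_on_insert)
qed (simp add: empty)

text \<open>The usual integral of a simple function, with the finitely additive \<pi> as weight.
  Negative values are allowed, because shifted functions \<open>s - e\<close> are integrated
  later.\<close>

definition simple_integral_fa :: "('a \<Rightarrow> real) \<Rightarrow> real" where
  "simple_integral_fa s = (\<Sum>y\<in>s ` space M. y * \<pi> (s -` {y} \<inter> space M))"

text \<open>Applied to a pair of simple functions, this evaluates both on a common partition.\<close>

lemma simple_integral_comp:
  assumes g: "simple_function M g"
  shows "simple_integral_fa (\<lambda>x. h (g x)) = (\<Sum>z\<in>g ` space M. h z * \<pi> (g -` {z} \<inter> space M))"
proof -
  have fin: "finite (g ` space M)" using g by (simp add: simple_function_def)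
  have img: "(\<lambda>x. h (g x)) ` space M = h ` g ` space M" by auto
  \<comment> \<open>A level set of the composite is the disjoint union of those fibres of
    \<open>g\<close> whose value \<open>h\<close> sends to \<open>y\<close>. There are finitely many
    of them, so finite additivity suffices.\<close>
  have "\<pi> ((\<lambda>x. h (g x)) -` {y} \<inter> space M) =
      (\<Sum>z\<in>{z \<in> g ` space M. h z = y}. \<pi> (g -` {z} \<inter> space M))" for y
  proof -
    have "(\<lambda>x. h (g x)) -` {y} \<inter> space M = (\<Union>z\<in>{z \<in> g ` space M. h z = y}. g -` {z} \<inter> space M)"
      by auto
    moreover have "\<pi> (\<Union>z\<in>{z \<in> g ` space M. h z = y}. g -` {z} \<inter> space M) =
        (\<Sum>z\<in>{z \<in> g ` space M. h z = y}. \<pi> (g -` {z} \<inter> space M))"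
      using fin g by (intro finite_union) (auto simp: simple_function_def disjoint_family_on_def)
    ultimately show ?thesis by simp
  qed
  then have "simple_integral_fa (\<lambda>x. h (g x)) =
      (\<Sum>y\<in>h ` g ` space M. \<Sum>z\<in>{z \<in> g ` space M. h z = y}. h z * \<pi> (g -` {z} \<inter> space M))"
    unfolding simple_integral_fa_def img by (simp add: sum_distrib_left)
  also have "\<dots> = (\<Sum>z\<in>g ` space M. h z * \<pi> (g -` {z} \<inter> space M))"
    using fin by (rule sum.image_gen[symmetric])
  finally show ?thesis .
qed

lemma simple_integral_linear:
  assumes "simple_function M s" "simple_function M t"
  shows "simple_integral_fa (\<lambda>x. a * s x + b * t x) = a * simple_integral_fa s + b * simple_integral_fa t"
proof -
  have p: "simple_function M (\<lambda>x. (s x, t x))" using assms by (rule simple_function_Pair)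
  show ?thesis
    using simple_integral_comp[OF p, of fst] simple_integral_comp[OF p, of snd]
      simple_integral_comp[OF p, of "\<lambda>z. a * fst z + b * snd z"]
    by (simp add: sum.distrib sum_distrib_left algebra_simps)
qed

lemma simple_integral_mono:
  assumes "simple_function M s" "simple_function M t" "\<And>x. x \<in> space M \<Longrightarrow> s x \<le> t x"
  shows "simple_integral_fa s \<le> simple_integral_fa t"
proof -
  have p: "simple_function M (\<lambda>x. (s x, t x))" using assms(1,2) by (rule simple_function_Pair)
  have "(\<Sum>z\<in>(\<lambda>x. (s x, t x)) ` space M. fst z * \<pi> ((\<lambda>x. (s x, t x)) -` {z} \<inter> space M))
      \<le> (\<Sum>z\<in>(\<lambda>x. (s x, t x)) ` space M. snd z * \<pi> ((\<lambda>x. (s x, t x)) -` {z} \<inter> space M))"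
    using p assms(3) by (intro sum_mono mult_right_mono nonneg) (auto simp: simple_function_def)
  then show ?thesis
    using simple_integral_comp[OF p, of fst] simple_integral_comp[OF p, of snd] by simp
qed

lemma simple_integral_indicator:
  assumes "A \<in> sets M"
  shows "simple_integral_fa (indicator A) = \<pi> A"
proof -
  \<comment> \<open>The sum is widened to both values 0 and 1, since one of them may not be attained
    when \<open>A\<close> is empty or the whole space. A value that is not attained has an empty
    fibre and contributes 0.\<close>
  have "simple_integral_fa (indicator A) =
      (\<Sum>y\<in>{0, 1}. y * \<pi> (indicator A -` {y} \<inter> space M))"
    unfolding simple_integral_fa_def
  proof (rule sum.mono_neutral_left)
    show "\<forall>y\<in>{0, 1} - indicator A ` space M. y * \<pi> (indicator A -` {y} \<inter> space M) = 0"
    proof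
      fix y :: real assume "y \<in> {0, 1} - indicator A ` space M"
      then have "indicator A -` {y} \<inter> space M = {}" by auto
      then show "y * \<pi> (indicator A -` {y} \<inter> space M) = 0" by (simp add: empty)
    qed
  qed (auto simp: indicator_def)
  moreover have "indicator A -` {1::real} \<inter> space M = A"
    using sets.sets_into_space[OF assms] by (auto simp: indicator_def)
  ultimately show ?thesis by simp
qed

lemma simple_integral_const: "simple_integral_fa (\<lambda>_. c) = c"
proof -
  \<comment> \<open>On an empty space the defining sum would be empty and give 0 instead of
    \<open>c\<close>; total mass 1 excludes this.\<close>
  have "space M \<noteq> {}" using empty space_one by auto
  then show ?thesis by (simp add: simple_integral_fa_def image_constant_conv space_one)
qed

text \<open>Since the total mass is 1, a uniform error \<open>e\<close> between functions becomes
  the same error \<open>e\<close> between integrals.\<close>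

lemma simple_integral_le_add:
  assumes "simple_function M s" "simple_function M t" "\<And>x. x \<in> space M \<Longrightarrow> s x \<le> t x + e"
  shows "simple_integral_fa s \<le> simple_integral_fa t + e"
proof -
  have "simple_integral_fa (\<lambda>x. 1 * t x + 1 * e) = 1 * simple_integral_fa t + 1 * simple_integral_fa (\<lambda>_. e)"
    by (rule simple_integral_linear[OF assms(2)]) simp
  moreover have "simple_integral_fa s \<le> simple_integral_fa (\<lambda>x. t x + e)"
    using assms by (intro simple_integral_mono simple_function_add) auto
  ultimately show ?thesis by (simp add: simple_integral_const)
qed

section \<open>Extension to all measurable maps\<close>

definition minorants :: "('a \<Rightarrow> real) \<Rightarrow> ('a \<Rightarrow> real) set" where
  "minorants f = {s. simple_function M s \<and> (\<forall>x\<in>space M. s x \<le> f x)}"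

text \<open>A supremum of reals, informative only if minorants exist and their integrals are bounded
  above. The lemmas below establish both before estimating it.\<close>

definition lower_integral :: "('a \<Rightarrow> real) \<Rightarrow> real" where
  "lower_integral f = (SUP s\<in>minorants f. simple_integral_fa s)"

lemma minorant_le:
  assumes "simple_function M t" "\<And>x. x \<in> space M \<Longrightarrow> f x \<le> t x + e" "s \<in> minorants f"
  shows "simple_integral_fa s \<le> simple_integral_fa t + e"
proof (rule simple_integral_le_add)
  show "simple_function M s" using assms(3) by (simp add: minorants_def)
  fix x assume x: "x \<in> space M"
  have "s x \<le> f x" using assms(3) x by (simp add: minorants_def)
  with assms(2)[OF x] show "s x \<le> t x + e" by linarith
qed (fact assms(1))

text \<open>The shifted function \<open>s - e\<close> is a minorant, and every minorant lies below
  \<open>s + e\<close>, so the supremum is squeezed around the integral of \<open>s\<close>. This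
  takes the place of monotone convergence, which may fail for a finitely additive \<pi>; error 0
  settles simple functions, and small errors give affinity.\<close>

lemma lower_integral_approx:
  assumes s: "simple_function M s" and close: "\<And>x. x \<in> space M \<Longrightarrow> \<bar>f x - s x\<bar> \<le> e"
  shows "\<bar>lower_integral f - simple_integral_fa s\<bar> \<le> e"
proof -
  have up: "simple_integral_fa t \<le> simple_integral_fa s + e" if "t \<in> minorants f" for t
    using s _ that by (rule minorant_le) (use close in \<open>fastforce simp: abs_le_iff\<close>)
  have shift: "simple_function M (\<lambda>x. s x - e)" using s by (intro simple_function_diff) auto
  have mem: "(\<lambda>x. s x - e) \<in> minorants f"
    using shift close by (auto simp: minorants_def abs_le_iff) (smt (verit) close)
  have "lower_integral f \<le> simple_integral_fa s + e"
    unfolding lower_integral_def using mem up by (intro cSUP_least) auto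
  moreover have "simple_integral_fa (\<lambda>x. s x - e) \<le> lower_integral f"
    unfolding lower_integral_def using mem up by (intro cSUP_upper bdd_aboveI2) auto
  moreover have "simple_integral_fa s \<le> simple_integral_fa (\<lambda>x. s x - e) + e"
    using s shift by (rule simple_integral_le_add) simp
  ultimately show ?thesis by linarith
qed

lemma lower_integral_simple:
  assumes "simple_function M s" "\<And>x. x \<in> space M \<Longrightarrow> f x = s x"
  shows "lower_integral f = simple_integral_fa s"
  using lower_integral_approx[OF assms(1), of f 0] assms(2) by simp

text \<open>Rounding \<open>f\<close> down to a multiple of \<open>e\<close> costs at most
  \<open>e\<close>, and boundedness of \<open>f\<close> leaves only finitely many multiples.\<close>

lemma ex_simple_approx:
  assumes f: "f \<in> Meas M" and e: "0 < e"
  shows "\<exists>s. simple_function M s \<and> (\<forall>x\<in>space M. \<bar>f x - s x\<bar> \<le> e)"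
proof -
  have [measurable]: "f \<in> borel_measurable M" using f by (auto simp: Meas_iff)
  define s where "s x = e * real_of_int \<lfloor>f x / e\<rfloor>" for x
  have "\<lfloor>f x / e\<rfloor> \<in> {0..\<lfloor>1 / e\<rfloor>}" if "x \<in> space M" for x
    using f that e by (auto simp: Meas_iff intro!: floor_mono divide_right_mono)
  then have "s ` space M \<subseteq> (\<lambda>k. e * real_of_int k) ` {0..\<lfloor>1 / e\<rfloor>}"
    by (auto simp: s_def)
  then have "finite (s ` space M)" by (rule finite_subset) simp
  moreover have "s \<in> borel_measurable M" unfolding s_def by measurable
  ultimately have "simple_function M s" by (intro simple_function_borel_measurable)
  moreover have "\<bar>f x - s x\<bar> \<le> e" for x
  proof -
    have "e * real_of_int \<lfloor>f x / e\<rfloor> \<le> e * (f x / e)"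
      "e * (f x / e) \<le> e * (real_of_int \<lfloor>f x / e\<rfloor> + 1)"
      using e by (intro mult_left_mono; linarith)+
    with e have "s x \<le> f x" "f x \<le> s x + e" by (simp_all add: s_def distrib_left)
    then show ?thesis using e by linarith
  qed
  ultimately show ?thesis by blast
qed

lemma lower_integral_bounds:
  assumes f: "f \<in> Meas M"
  shows "lower_integral f \<in> unit_I"
proof -
  have mem: "(\<lambda>_. 0) \<in> minorants f" using f by (auto simp: minorants_def Meas_iff)
  have up: "simple_integral_fa s \<le> 1" if "s \<in> minorants f" for s
    using minorant_le[of "\<lambda>_. 1" f 0 s] f that by (auto simp: Meas_iff simple_integral_const)
  have "lower_integral f \<le> 1"
    unfolding lower_integral_def using mem up by (intro cSUP_least) auto
  moreover have "simple_integral_fa (\<lambda>_. 0) \<le> lower_integral f"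
    unfolding lower_integral_def using mem up by (intro cSUP_upper bdd_aboveI2) auto
  ultimately show ?thesis by (simp add: simple_integral_const)
qed

lemma lower_integral_affine:
  assumes f: "f \<in> Meas M" and g: "g \<in> Meas M" and r: "r \<in> unit_I"
  shows "lower_integral (cvx_comb M r f g) = r * lower_integral f + (1 - r) * lower_integral g"
    (is "?L = ?R")
proof -
  \<comment> \<open>A convex combination of two errors is no larger than their common bound, so the
    estimates below lose nothing.\<close>
  have cvx_le: "\<bar>r * a + (1 - r) * b\<bar> \<le> e" if "\<bar>a\<bar> \<le> e" "\<bar>b\<bar> \<le> e" for a b e :: real
  proof -
    have "\<bar>r * a + (1 - r) * b\<bar> \<le> \<bar>r * a\<bar> + \<bar>(1 - r) * b\<bar>" by (rule abs_triangle_ineq)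
    also have "\<dots> \<le> r * e + (1 - r) * e"
      using r that by (intro add_mono) (auto simp: abs_mult intro: mult_left_mono)
    finally show ?thesis by (simp add: algebra_simps)
  qed
  have close: "\<bar>?L - ?R\<bar> \<le> e" if "0 < e" for e
  proof -
    \<comment> \<open>Both sides are compared with the same convex combination of simple integrals;
      each comparison uses half of \<open>e\<close>.\<close>
    have "0 < e / 2" using that by simp
    with f g obtain s t where st: "simple_function M s" "simple_function M t"
      and s: "\<And>x. x \<in> space M \<Longrightarrow> \<bar>f x - s x\<bar> \<le> e / 2"
      and t: "\<And>x. x \<in> space M \<Longrightarrow> \<bar>g x - t x\<bar> \<le> e / 2"
      using ex_simple_approx by metis
    have "simple_function M (\<lambda>x. r * s x + (1 - r) * t x)"
      using st by (intro simple_function_add simple_function_mult) auto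
    moreover have "\<bar>cvx_comb M r f g x - (r * s x + (1 - r) * t x)\<bar> \<le> e / 2" if "x \<in> space M" for x
      using cvx_le[OF s[OF that] t[OF that]] that by (simp add: cvx_comb_def algebra_simps)
    ultimately have "\<bar>?L - simple_integral_fa (\<lambda>x. r * s x + (1 - r) * t x)\<bar> \<le> e / 2"
      by (rule lower_integral_approx)
    then have 1: "\<bar>?L - (r * simple_integral_fa s + (1 - r) * simple_integral_fa t)\<bar> \<le> e / 2"
      by (simp only: simple_integral_linear[OF st])
    have "\<bar>r * (lower_integral f - simple_integral_fa s)
        + (1 - r) * (lower_integral g - simple_integral_fa t)\<bar> \<le> e / 2"
      using s t by (intro cvx_le lower_integral_approx st)
    then have 2: "\<bar>?R - (r * simple_integral_fa s + (1 - r) * simple_integral_fa t)\<bar> \<le> e / 2"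
      by (simp add: algebra_simps)
    show ?thesis using 1 2 by linarith
  qed
  have "\<bar>?L - ?R\<bar> \<le> 0" by (rule field_le_epsilon) (use close in auto)
  then show ?thesis by simp
qed

lemma lower_integral_op: "restrict lower_integral (Meas M) \<in> fa_integration_ops M"
  unfolding fa_integration_ops_def
proof (intro CollectI conjI)
  show "restrict lower_integral (Meas M) \<in> Meas M \<rightarrow>\<^sub>E unit_I"
    using lower_integral_bounds by (intro restrict_PiE_iff[THEN iffD2]) blast
  show "affine_op M (restrict lower_integral (Meas M))"
    by (simp add: affine_op_def cvx_comb_Meas lower_integral_affine)
  have "lower_integral (const_map M r) = r" for r
    using lower_integral_simple[of "\<lambda>_. r" "const_map M r"]
    by (simp add: const_map_def simple_integral_const)
  then show "weakly_averaging M (restrict lower_integral (Meas M))"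
    by (simp add: weakly_averaging_def const_map_Meas)
qed

lemma Lam_lower_integral: "Lam M (restrict lower_integral (Meas M)) = \<pi>"
proof (rule extensionalityI)
  show "Lam M (restrict lower_integral (Meas M)) \<in> extensional (sets M)" by (simp add: Lam_def)
  show "\<pi> \<in> extensional (sets M)" using fa by (auto simp: fa_prob_measures_def PiE_def)
  fix A assume A: "A \<in> sets M"
  have "lower_integral (char_map M A) = \<pi> A"
    using lower_integral_simple[of "indicator A" "char_map M A"] A
    by (simp add: char_map_def simple_integral_indicator)
  then show "Lam M (restrict lower_integral (Meas M)) A = \<pi> A"
    using A by (simp add: Lam_def char_map_Meas)
qed

end

section \<open>The bijection in the finitely additive case\<close>

lemma Lam_fa_prob:
  assumes \<phi>: "\<phi> \<in> fa_integration_ops M"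
  shows "Lam M \<phi> \<in> fa_prob_measures M"
  unfolding fa_prob_measures_def
proof (intro CollectI conjI)
  show "Lam M \<phi> \<in> sets M \<rightarrow>\<^sub>E unit_I"
    using fa_op_bounds[OF \<phi> char_map_Meas] by (auto simp: Lam_def)
  have "char_map M (space M) = const_map M 1"
    by (rule extensionalityI[of _ "space M"]) (auto simp: char_map_def const_map_def)
  then show "Lam M \<phi> (space M) = 1" using fa_op_const[OF \<phi>, of 1] by (simp add: Lam_def)
  show "additive (sets M) (Lam M \<phi>)"
    unfolding additive_def
  proof (intro ballI impI)
    fix A B assume AB: "A \<in> sets M" "B \<in> sets M" "A \<inter> B = {}"
    \<comment> \<open>For disjoint sets the characteristic functions add up without leaving the unit
      interval.\<close>
    have "\<phi> (char_map M (A \<union> B)) = \<phi> (char_map M A) + \<phi> (char_map M B)"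
      using AB by (intro fa_op_add[OF \<phi>] char_map_Meas) (auto simp: char_map_def indicator_def)
    then show "Lam M \<phi> (A \<union> B) = Lam M \<phi> A + Lam M \<phi> B" using AB by (simp add: Lam_def)
  qed
qed

lemma Lam_bij: "bij_betw (Lam M) (fa_integration_ops M) (fa_prob_measures M)"
  unfolding bij_betw_def
proof (intro conjI subset_antisym)
  show "inj_on (Lam M) (fa_integration_ops M)"
  proof (rule inj_onI)
    fix \<phi> \<psi> assume *: "\<phi> \<in> fa_integration_ops M" "\<psi> \<in> fa_integration_ops M" "Lam M \<phi> = Lam M \<psi>"
    show "\<phi> = \<psi>"
      using *(1,2)
    proof (rule fa_op_eqI)
      fix A assume "A \<in> sets M"
      then show "\<phi> (char_map M A) = \<psi> (char_map M A)"
        using fun_cong[OF *(3), of A] by (simp add: Lam_def)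
    qed
  qed
  show "Lam M ` fa_integration_ops M \<subseteq> fa_prob_measures M" using Lam_fa_prob by blast
  show "fa_prob_measures M \<subseteq> Lam M ` fa_integration_ops M"
  proof
    fix \<pi> assume "\<pi> \<in> fa_prob_measures M"
    then interpret fa_prob M \<pi> by unfold_locales
    show "\<pi> \<in> Lam M ` fa_integration_ops M"
      using lower_integral_op Lam_lower_integral by (intro image_eqI) auto
  qed
qed

section \<open>Countable additivity\<close>

lemma Lam_prob:
  assumes \<phi>: "\<phi> \<in> integration_ops M"
  shows "Lam M \<phi> \<in> prob_measures M"
  unfolding prob_measures_def
proof (intro CollectI conjI allI impI)
  have \<phi>S: "\<phi> \<in> fa_integration_ops M" and lim: "respects_limits M \<phi>"
    using \<phi> by (auto simp: integration_ops_def)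
  show fa: "Lam M \<phi> \<in> fa_prob_measures M" using \<phi>S by (rule Lam_fa_prob)
  interpret fa_prob M "Lam M \<phi>" using fa by unfold_locales
  fix A :: "nat \<Rightarrow> 'a set" assume A: "range A \<subseteq> sets M" and disj: "disjoint_family A"
  have disjD: "i = j" if "x \<in> A i" "x \<in> A j" for x i j
    using disj that unfolding disjoint_family_on_def by blast
  \<comment> \<open>The tails of the union. Each point lies in at most one \<open>A k\<close>, so
    their characteristic functions tend to 0 pointwise, as the limit condition requires.\<close>
  define T where "T n = (\<Union>k\<in>{n..}. A k)" for n
  have T: "T n \<in> sets M" for n unfolding T_def using A by (intro sets.countable_UN') auto
  \<comment> \<open>Finite additivity alone writes the total as a partial sum plus a tail value,
    which reduces the series to showing that the tail values tend to 0.\<close>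
  have split: "Lam M \<phi> (\<Union>k. A k) = (\<Sum>k<n. Lam M \<phi> (A k)) + Lam M \<phi> (T n)" for n
  proof -
    have "(\<Union>k. A k) = (\<Union>k<n. A k) \<union> T n"
      unfolding T_def by (auto simp: Bex_def) (meson not_le)
    moreover have "(\<Union>k<n. A k) \<inter> T n = {}"
    proof (rule Int_emptyI)
      fix x assume "x \<in> (\<Union>k<n. A k)" "x \<in> T n"
      then obtain i j where ij: "i < n" "n \<le> j" "x \<in> A i" "x \<in> A j" by (auto simp: T_def)
      with disjD[OF ij(3,4)] show False by simp
    qed
    moreover have "(\<Union>k<n. A k) \<in> sets M" using A by (intro sets.finite_UN) auto
    ultimately have "Lam M \<phi> (\<Union>k. A k) = Lam M \<phi> (\<Union>k<n. A k) + Lam M \<phi> (T n)"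
      using union[OF _ T] by metis
    also have "Lam M \<phi> (\<Union>k<n. A k) = (\<Sum>k<n. Lam M \<phi> (A k))"
      using A disj by (intro finite_union) (auto simp: disjoint_family_on_def)
    finally show ?thesis .
  qed
  have "(\<lambda>n. char_map M (T n) x) \<longlonglongrightarrow> 0" if x: "x \<in> space M" for x
  proof -
    \<comment> \<open>If \<open>x\<close> lies in \<open>A j\<close>, then by disjointness every
      later set misses \<open>x\<close>; if it lies in no set, any index works.\<close>
    obtain m where m: "x \<notin> A k" if "k \<ge> m" for k
    proof (cases "\<exists>j. x \<in> A j")
      case True
      then obtain j where "x \<in> A j" by blast
      then have "x \<notin> A k" if "k \<ge> Suc j" for k
        using disjD[of x j k] that by auto
      then show ?thesis by (intro that[of "Suc j"])
    next
      case False
      then show ?thesis by (intro that[of 0]) blast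
    qed
    have "char_map M (T n) x = 0" if "n \<ge> m" for n
    proof -
      have "x \<notin> A k" if "k \<in> {n..}" for k using m[of k] that \<open>n \<ge> m\<close> by simp
      then show ?thesis using x by (simp add: char_map_def T_def)
    qed
    then show ?thesis
      by (intro tendsto_eventually) (auto simp: eventually_sequentially)
  qed
  then have "(\<lambda>n. \<phi> (char_map M (T n))) \<longlonglongrightarrow> 0"
    using lim char_map_Meas[OF T] unfolding respects_limits_def
    by (elim allE[of _ "\<lambda>n. char_map M (T n)"]) auto
  then have "(\<lambda>n. Lam M \<phi> (T n)) \<longlonglongrightarrow> 0" using T by (simp add: Lam_def)
  then have "(\<lambda>n. Lam M \<phi> (\<Union>k. A k) - Lam M \<phi> (T n)) \<longlonglongrightarrow> Lam M \<phi> (\<Union>k. A k) - 0"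
    by (intro tendsto_intros)
  moreover have "Lam M \<phi> (\<Union>k. A k) - Lam M \<phi> (T n) = (\<Sum>k<n. Lam M \<phi> (A k))" for n
    using split[of n] by linarith
  ultimately show "(\<lambda>n. Lam M \<phi> (A n)) sums Lam M \<phi> (\<Union>n. A n)"
    by (simp add: sums_def)
qed

text \<open>The operator is not analysed directly: it agrees on characteristic functions with the
  Lebesgue integral for its own measure, hence everywhere by uniqueness, and then inherits dominated
  convergence.\<close>

lemma prob_measures_Lam:
  assumes \<phi>: "\<phi> \<in> fa_integration_ops M" and \<pi>: "Lam M \<phi> \<in> prob_measures M"
  shows "\<phi> \<in> integration_ops M"
proof -
  have fa: "Lam M \<phi> \<in> fa_prob_measures M" using \<phi> by (rule Lam_fa_prob)
  interpret fa_prob M "Lam M \<phi>" using fa by unfold_locales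
  \<comment> \<open>A fresh measure on the sigma-algebra of \<open>M\<close>, since the measure
    carried by \<open>M\<close> is unrelated to \<phi>.\<close>
  define \<mu> where "\<mu> = measure_of (space M) (sets M) (\<lambda>A. ennreal (Lam M \<phi> A))"
  have space_\<mu> [simp]: "space \<mu> = space M" and sets_\<mu> [simp, measurable_cong]: "sets \<mu> = sets M"
    by (simp_all add: \<mu>_def)
  have em: "emeasure \<mu> A = ennreal (Lam M \<phi> A)" if "A \<in> sets M" for A
  proof (rule emeasure_measure_of[OF \<mu>_def])
    show "countably_additive (sets \<mu>) (\<lambda>A. ennreal (Lam M \<phi> A))"
    proof (rule countably_additiveI)
      fix A :: "nat \<Rightarrow> 'a set" assume A: "range A \<subseteq> sets \<mu>" "disjoint_family A"
      then have "(\<lambda>n. Lam M \<phi> (A n)) sums Lam M \<phi> (\<Union>n. A n)"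
        using \<pi> by (simp add: prob_measures_def)
      then show "(\<Sum>i. ennreal (Lam M \<phi> (A i))) = ennreal (Lam M \<phi> (\<Union>i. A i))"
        using A nonneg by (intro suminf_ennreal_eq) auto
    qed
  qed (use that empty sets.space_closed in \<open>auto simp: positive_def\<close>)
  have one: "measure \<mu> (space M) = 1" by (simp add: measure_def em space_one)
  interpret \<mu>: finite_measure \<mu> by (rule finite_measureI) (simp add: em)
  have int: "integrable \<mu> f" if "f \<in> Meas M" for f
    using that by (intro \<mu>.integrable_const_bound[where B = 1]) (auto simp: Meas_iff)
  define \<psi> where "\<psi> = (\<lambda>f\<in>Meas M. integral\<^sup>L \<mu> f)"
  have "\<psi> \<in> fa_integration_ops M"
    unfolding fa_integration_ops_def
  proof (intro CollectI conjI)
    have "integral\<^sup>L \<mu> f \<in> unit_I" if f: "f \<in> Meas M" for f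
    proof -
      have "integral\<^sup>L \<mu> f \<le> integral\<^sup>L \<mu> (\<lambda>_. 1)"
        using f by (intro integral_mono int[OF f]) (auto simp: Meas_iff)
      moreover have "0 \<le> integral\<^sup>L \<mu> f"
        using f by (intro integral_nonneg_AE AE_I2) (auto simp: Meas_iff)
      ultimately show ?thesis by (simp add: one)
    qed
    then show "\<psi> \<in> Meas M \<rightarrow>\<^sub>E unit_I" unfolding \<psi>_def by (simp only: restrict_PiE_iff ball_simps) blast
    show "affine_op M \<psi>"
      unfolding affine_op_def
    proof (intro ballI)
      fix f g r assume fgr: "f \<in> Meas M" "g \<in> Meas M" "r \<in> unit_I"
      have "integral\<^sup>L \<mu> (cvx_comb M r f g) = integral\<^sup>L \<mu> (\<lambda>x. r * f x + (1 - r) * g x)"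
        by (intro Bochner_Integration.integral_cong) (auto simp: cvx_comb_def)
      also have "\<dots> = r * integral\<^sup>L \<mu> f + (1 - r) * integral\<^sup>L \<mu> g"
        using int fgr by simp
      finally show "\<psi> (cvx_comb M r f g) = r * \<psi> f + (1 - r) * \<psi> g"
        using fgr by (simp add: \<psi>_def cvx_comb_Meas)
    qed
    have "integral\<^sup>L \<mu> (const_map M r) = r" for r
    proof -
      have "integral\<^sup>L \<mu> (const_map M r) = integral\<^sup>L \<mu> (\<lambda>_. r)"
        by (intro Bochner_Integration.integral_cong) (auto simp: const_map_def)
      then show ?thesis by (simp add: one)
    qed
    then show "weakly_averaging M \<psi>"
      by (simp add: weakly_averaging_def \<psi>_def const_map_Meas)
  qed
  then have eq: "\<phi> = \<psi>"
  proof (rule fa_op_eqI[OF \<phi>])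
    fix A assume A: "A \<in> sets M"
    have "integral\<^sup>L \<mu> (char_map M A) = integral\<^sup>L \<mu> (indicator A)"
      by (intro Bochner_Integration.integral_cong) (auto simp: char_map_def)
    also have "\<dots> = Lam M \<phi> A"
      using A sets.sets_into_space[OF A] nonneg[OF A] by (simp add: measure_def em Int_absorb2)
    finally show "\<phi> (char_map M A) = \<psi> (char_map M A)"
      using A by (simp add: \<psi>_def char_map_Meas Lam_def)
  qed
  have "respects_limits M \<psi>"
    unfolding respects_limits_def
  proof (intro allI impI)
    fix f :: "nat \<Rightarrow> 'a \<Rightarrow> real"
    assume f: "\<forall>n. f n \<in> Meas M" and lim: "\<forall>x\<in>space M. (\<lambda>n. f n x) \<longlonglongrightarrow> 0"
    have "(\<lambda>n. integral\<^sup>L \<mu> (f n)) \<longlonglongrightarrow> integral\<^sup>L \<mu> (\<lambda>_. 0)"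
    \<comment> \<open>The constant 1 dominates every map into the unit interval and is integrable
      because \<open>\<mu>\<close> is finite.\<close>
    proof (rule integral_dominated_convergence[where w = "\<lambda>_. 1"])
      show "f n \<in> borel_measurable \<mu>" for n using int f by blast
    qed (use f lim in \<open>auto simp: Meas_iff\<close>)
    then show "(\<lambda>n. \<psi> (f n)) \<longlonglongrightarrow> 0" using f by (simp add: \<psi>_def)
  qed
  with \<phi> eq show ?thesis by (simp add: integration_ops_def)
qed

theorem proposition3p6:
  fixes M :: "'a measure"
  shows "bij_betw (Lam M) (fa_integration_ops M) (fa_prob_measures M) \<and>
         bij_betw (Lam M) (integration_ops M) (prob_measures M)"
proof
  show bij: "bij_betw (Lam M) (fa_integration_ops M) (fa_prob_measures M)" by (rule Lam_bij)
  have sub: "integration_ops M \<subseteq> fa_integration_ops M" by (auto simp: integration_ops_def)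
  \<comment> \<open>Injectivity is inherited from the larger domain, so only the image is at stake:
    the finitely additive preimage of a probability measure must itself respect limits.\<close>
  have "Lam M ` integration_ops M = prob_measures M"
  proof (intro subset_antisym subsetI)
    fix \<pi> assume \<pi>: "\<pi> \<in> prob_measures M"
    then have "\<pi> \<in> Lam M ` fa_integration_ops M"
      using bij by (simp add: bij_betw_def prob_measures_def)
    with \<pi> show "\<pi> \<in> Lam M ` integration_ops M" using prob_measures_Lam by blast
  qed (use Lam_prob in blast)
  with bij sub show "bij_betw (Lam M) (integration_ops M) (prob_measures M)"
    by (auto simp: bij_betw_def intro: inj_on_subset)
qed

end
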